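(* Let $f\colon\mathbb{R}\to\mathbb{R}$ be a bounded, continuously differentiable function with bounded derivative, let $J\in\mathbb{N}$, and let $\boldsymbol{c}^{(J)}=f|_{2^{-J}\mathbb{Z}}$, that is, $c^{(J)}_k=f(2^{-J}k)$ for $k\in\mathbb{Z}$. Let $\boldsymbol{\alpha}^{(1)},\dots,\boldsymbol{\alpha}^{(J)}$ be finitely supported real masks with $\sum_{i}\alpha^{(\ell)}_{2i}=\sum_{i}\alpha^{(\ell)}_{2i+1}=1$ for $\ell=1,\dots,J$, with subdivision operators $\mathcal{S}_{\boldsymbol{\alpha}^{(\ell)}}$, and let $\mathcal{D}_{\boldsymbol{\gamma}^{(\ell)}}$, $\ell=1,\dots,J$, be the corresponding decimation operators, i.e. $\boldsymbol{\gamma}^{(\ell)}$ is an absolutely summable real bi-infinite sequence with $\boldsymbol{\gamma}^{(\ell)}*(\boldsymbol{\alpha}^{(\ell)}\downarrow 2)=\boldsymbol{\delta}$. Assume that $\sum_{i\in\mathbb{Z}}\gamma^{(\ell)}_i=1$ and $\sum_{i\in\mathbb{Z}}|i|\,|\gamma^{(\ell)}_i|<\infty$ for $\ell=1,\dots,J$. Let $\boldsymbol{d}^{(1)},\dots,\boldsymbol{d}^{(J)}$ be the detail coefficients obtained from $\boldsymbol{c}^{(J)}$ by iterating, for $\ell=J,J-1,\dots,1$, $$\boldsymbol{c}^{(\ell-1)}=\mathcal{D}_{\boldsymbol{\gamma}^{(\ell)}}\boldsymbol{c}^{(\ell)},\qquad \boldsymbol{d}^{(\ell)}=\boldsymbol{c}^{(\ell)}-\mathcal{S}_{\boldsymbol{\alpha}^{(\ell)}}\boldsymbol{c}^{(\ell-1)}.$$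 Then $$\|\boldsymbol{d}^{(\ell)}\|_\infty\le\Big(K_{\boldsymbol{\alpha}^{(\ell)},\boldsymbol{\gamma}^{(\ell)}}\cdot\|f'\|_\infty\cdot\prod_{m=\ell+1}^{J}\|\boldsymbol{\gamma}^{(m)}\|_1\Big)\,2^{-\ell},\qquad \ell=1,\dots,J,$$ where $K_{\boldsymbol{\alpha}^{(\ell)},\boldsymbol{\gamma}^{(\ell)}}=K_{\boldsymbol{\gamma}^{(\ell)}}\|\boldsymbol{\alpha}^{(\ell)}\|_1+K_{\boldsymbol{\alpha}^{(\ell)}}\|\boldsymbol{\gamma}^{(\ell)}\|_1$, with $K_{\boldsymbol{\gamma}^{(\ell)}}=2\sum_{i\in\mathbb{Z}}|\gamma^{(\ell)}_i|\,|i|$ and $K_{\boldsymbol{\alpha}^{(\ell)}}=\sum_{i\in\mathbb{Z}}|\alpha^{(\ell)}_i|\,|i|$, and the empty product (occurring for $\ell=J$) equals $1$.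
   Context: Sequences are real-valued and bi-infinite (indexed by $\mathbb{Z}$). For a finitely supported sequence (mask) $\boldsymbol{\alpha}$, the subdivision operator is $(\mathcal{S}_{\boldsymbol{\alpha}}\boldsymbol{c})_j=\sum_{i\in\mathbb{Z}}\alpha_{j-2i}c_i$, $j\in\mathbb{Z}$. For an absolutely summable sequence $\boldsymbol{\gamma}$, the decimation operator is $(\mathcal{D}_{\boldsymbol{\gamma}}\boldsymbol{c})_j=\sum_{i\in\mathbb{Z}}\gamma_{j-i}c_{2i}$, $j\in\mathbb{Z}$ (applied to bounded sequences). The downsampling operator is $(\boldsymbol{c}\downarrow 2)_j=c_{2j}$; $*$ is convolution of sequences; $\boldsymbol{\delta}$ is the Kronecker delta sequence ($\delta_0=1$, $\delta_i=0$ for $i\ne0$). $\|\boldsymbol{c}\|_\infty=\sup_j|c_j|$, $\|\boldsymbol{c}\|_1=\sum_j|c_j|$, and $\|f'\|_\infty=\sup_{x\in\mathbb{R}}|f'(x)|$. *)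

theory Defs
  imports "HOL-Analysis.Analysis"
begin

text \<open>
  A bi-infinite real sequence is a function of type \<^typ>\<open>int \<Rightarrow> real\<close>.  All sums over the
  integers are unconditional sums \<^const>\<open>infsum\<close>; such a sum is \<open>0\<close> when the family is not
  summable, so summability is always assumed explicitly where it is not automatic.
\<close>

definition subdivision :: "(int \<Rightarrow> real) \<Rightarrow> (int \<Rightarrow> real) \<Rightarrow> int \<Rightarrow> real" where
  "subdivision \<alpha> c = (\<lambda>j. \<Sum>\<^sub>\<infinity>i. \<alpha> (j - 2 * i) * c i)"

definition decimation :: "(int \<Rightarrow> real) \<Rightarrow> (int \<Rightarrow> real) \<Rightarrow> int \<Rightarrow> real" where
  "decimation \<gamma> c = (\<lambda>j. \<Sum>\<^sub>\<infinity>i. \<gamma> (j - i) * c (2 * i))"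

definition downsample :: "(int \<Rightarrow> real) \<Rightarrow> int \<Rightarrow> real" where
  "downsample c = (\<lambda>j. c (2 * j))"

definition convolution :: "(int \<Rightarrow> real) \<Rightarrow> (int \<Rightarrow> real) \<Rightarrow> int \<Rightarrow> real" where
  "convolution a b = (\<lambda>j. \<Sum>\<^sub>\<infinity>i. a (j - i) * b i)"

definition kronecker_delta :: "int \<Rightarrow> real" where
  "kronecker_delta = (\<lambda>i. if i = 0 then 1 else 0)"

text \<open>The next two are meaningful norms only for bounded functions and for absolutely summable
  sequences, respectively.\<close>

definition sup_norm :: "('a \<Rightarrow> real) \<Rightarrow> real" where
  "sup_norm g = (SUP x. \<bar>g x\<bar>)"

definition l1_norm :: "(int \<Rightarrow> real) \<Rightarrow> real" where
  "l1_norm a = (\<Sum>\<^sub>\<infinity>i. \<bar>a i\<bar>)"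

definition K_mask :: "(int \<Rightarrow> real) \<Rightarrow> real" where
  "K_mask \<alpha> = (\<Sum>\<^sub>\<infinity>i. \<bar>\<alpha> i\<bar> * real_of_int \<bar>i\<bar>)"

definition K_decimation :: "(int \<Rightarrow> real) \<Rightarrow> real" where
  "K_decimation \<gamma> = 2 * (\<Sum>\<^sub>\<infinity>i. \<bar>\<gamma> i\<bar> * real_of_int \<bar>i\<bar>)"

definition K_pair :: "(int \<Rightarrow> real) \<Rightarrow> (int \<Rightarrow> real) \<Rightarrow> real" where
  "K_pair \<alpha> \<gamma> = K_decimation \<gamma> * l1_norm \<alpha> + K_mask \<alpha> * l1_norm \<gamma>"

end

theory Submission imports Defs begin

text \<open>
  The argument rests on one quantity, a global Lipschitz constant of the data at each level,
  together with the fact that prediction and decimation both preserve constants.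

  Decimation reads its input at the even places, so it doubles distances, and it averages with the
  weights \<^term>\<open>\<gamma>\<close>; hence it turns an \<open>L\<close>-Lipschitz sequence into a
  \<open>2 L \<parallel>\<gamma>\<parallel>\<^sub>1\<close>-Lipschitz one (\<open>decimation_lipschitz\<close>).  The samples of \<^term>\<open>f\<close> on the grid of
  width \<open>2\<^sup>-\<^sup>J\<close> are \<open>\<parallel>f'\<parallel>\<^sub>\<infinity> 2\<^sup>-\<^sup>J\<close>-Lipschitz by the mean value theorem.  Going down from level \<open>J\<close> to
  level \<open>l\<close>, the factors \<open>2\<close> turn \<open>2\<^sup>-\<^sup>J\<close> into \<open>2\<^sup>-\<^sup>l\<close>, and the factors \<open>\<parallel>\<gamma>\<parallel>\<^sub>1\<close> collect into the product
  in the claim.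

  A detail coefficient compares \<open>c\<^sub>j\<close> with an affine combination of values of \<^term>\<open>c\<close>.  Because
  \<^term>\<open>\<gamma>\<close> has total mass one, as does either half (even or odd) of the mask \<^term>\<open>\<alpha>\<close>, the number
  \<open>c\<^sub>j\<close> can be moved under both sums:
  \<open>d\<^sub>j = (\<Sum>i. \<alpha>\<^sub>j\<^sub>-\<^sub>2\<^sub>i (\<Sum>k. \<gamma>\<^sub>k (c\<^sub>j - c\<^sub>2\<^sub>i\<^sub>-\<^sub>2\<^sub>k)))\<close>.
  The inner difference is at most \<open>L (\<bar>j - 2 i\<bar> + 2 \<bar>k\<bar>)\<close>.  Summing it against
  \<open>\<bar>\<gamma>\<^sub>k\<bar>\<close> and then \<open>\<bar>\<alpha>\<^sub>j\<^sub>-\<^sub>2\<^sub>i\<bar>\<close> produces the first moments and the \<open>\<ell>\<^sup>1\<close> norms which make up the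
  constant \<^const>\<open>K_pair\<close> (\<open>detail_bound\<close>).
\<close>

section \<open>Sums over the integers\<close>

lemma abs_infsum_le:
  fixes f g :: "'a \<Rightarrow> real"
  assumes "g summable_on A" and "\<And>x. x \<in> A \<Longrightarrow> \<bar>f x\<bar> \<le> g x"
  shows "f summable_on A" and "\<bar>infsum f A\<bar> \<le> infsum g A"
proof -
  have "(\<lambda>x. norm (f x)) summable_on A"
    by (rule Infinite_Sum.abs_summable_on_comparison_test'[OF assms(1)]) (use assms(2) in auto)
  then show f: "f summable_on A"
    by (rule abs_summable_summable)
  show "\<bar>infsum f A\<bar> \<le> infsum g A"
    using norm_infsum_le[OF has_sum_infsum[OF f] has_sum_infsum[OF assms(1)]] assms(2) by simp
qed

lemma has_sum_diff:
  fixes f g :: "'a \<Rightarrow> real"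
  assumes "(f has_sum a) A" and "(g has_sum b) A"
  shows "((\<lambda>x. f x - g x) has_sum a - b) A"
  using has_sum_add[OF assms(1) has_sum_cmult_right[OF assms(2), of "-1"]] by simp

lemma infsum_even_shift_le:
  fixes g :: "int \<Rightarrow> real"
  assumes "g summable_on UNIV" and "\<And>x. 0 \<le> g x"
  shows "(\<lambda>i. g (j - 2 * i)) summable_on UNIV"
    and "(\<Sum>\<^sub>\<infinity>i. g (j - 2 * i)) \<le> infsum g UNIV"
proof -
  let ?h = "\<lambda>i::int. j - 2 * i"
  have inj: "inj ?h"
    by (auto simp: inj_on_def)
  have sub: "g summable_on range ?h"
    using assms(1) by (rule summable_on_subset_banach) simp
  then show "(\<lambda>i. g (j - 2 * i)) summable_on UNIV"
    using summable_on_reindex[OF inj, of g] by (simp add: o_def)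
  have "infsum g (range ?h) \<le> infsum g UNIV"
    by (rule infsum_mono_neutral[OF sub assms(1)]) (auto simp: assms(2))
  then show "(\<Sum>\<^sub>\<infinity>i. g (j - 2 * i)) \<le> infsum g UNIV"
    using infsum_reindex[OF inj, of g] by (simp add: o_def)
qed

text \<open>Subdivision applies only the entries of the mask whose parity is that of the output index,
  so constants are reproduced exactly when both parity classes have mass one.\<close>

lemma infsum_parity_class_mask:
  fixes \<alpha> :: "int \<Rightarrow> real"
  assumes even: "(\<Sum>\<^sub>\<infinity>i. \<alpha> (2 * i)) = 1" and odd: "(\<Sum>\<^sub>\<infinity>i. \<alpha> (2 * i + 1)) = 1"
  shows "(\<Sum>\<^sub>\<infinity>i. \<alpha> (j - 2 * i)) = 1"
proof -
  define m where "m = j div 2"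
  have bij: "bij_betw (\<lambda>i. m - i) UNIV UNIV"
    by (rule bij_betwI[where g = "\<lambda>i. m - i"]) auto
  have "j = 2 * m \<or> j = 2 * m + 1"
    unfolding m_def by presburger
  then show ?thesis
  proof
    assume "j = 2 * m"
    then show ?thesis
      using infsum_reindex_bij_betw[OF bij, of "\<lambda>i. \<alpha> (2 * i)"] even by (simp add: algebra_simps)
  next
    assume "j = 2 * m + 1"
    then show ?thesis
      using infsum_reindex_bij_betw[OF bij, of "\<lambda>i. \<alpha> (2 * i + 1)"] odd by (simp add: algebra_simps)
  qed
qed

section \<open>Lipschitz sequences under decimation\<close>

definition lipschitz_seq :: "real \<Rightarrow> (int \<Rightarrow> real) \<Rightarrow> bool" where
  "lipschitz_seq L c \<longleftrightarrow> (\<forall>i j. \<bar>c i - c j\<bar> \<le> L * real_of_int \<bar>i - j\<bar>)"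

lemma lipschitz_seqD: "lipschitz_seq L c \<Longrightarrow> \<bar>c i - c j\<bar> \<le> L * real_of_int \<bar>i - j\<bar>"
  by (simp add: lipschitz_seq_def)

lemma lipschitz_seq_nonneg: "lipschitz_seq L c \<Longrightarrow> 0 \<le> L"
  using lipschitz_seqD[of L c 1 0] by simp

text \<open>In this form the filter index no longer depends on the output index, so that two outputs of
  the operator can be subtracted term by term.\<close>

lemma decimation_filter_form:
  "decimation \<gamma> c j = (\<Sum>\<^sub>\<infinity>k. \<gamma> k * c (2 * j - 2 * k))"
proof -
  have "bij_betw (\<lambda>i. j - i) UNIV UNIV"
    by (rule bij_betwI[where g = "\<lambda>i. j - i"]) auto
  then show ?thesis
    unfolding decimation_def
    using infsum_reindex_bij_betw[of "\<lambda>i. j - i" UNIV UNIV "\<lambda>k. \<gamma> k * c (2 * j - 2 * k)"]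
    by (simp add: algebra_simps)
qed

locale moment_filter =
  fixes \<gamma> :: "int \<Rightarrow> real"
  assumes summable: "(\<lambda>k. \<bar>\<gamma> k\<bar>) summable_on UNIV"
    and moment: "(\<lambda>k. real_of_int \<bar>k\<bar> * \<bar>\<gamma> k\<bar>) summable_on UNIV"
    and mass: "(\<Sum>\<^sub>\<infinity>k. \<gamma> k) = 1"
begin

lemma filter_summable: "\<gamma> summable_on UNIV"
  using summable by (simp add: abs_summable_summable)

lemma l1_norm_nonneg: "0 \<le> l1_norm \<gamma>"
  by (simp add: l1_norm_def infsum_nonneg)

lemma K_decimation_nonneg: "0 \<le> K_decimation \<gamma>"
  by (simp add: K_decimation_def infsum_nonneg)

text \<open>The growth rate \<open>L (n + 2 \<bar>k\<bar>)\<close> is that of an \<open>L\<close>-Lipschitz sequence sampled at the even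
  places as seen from a point at distance \<open>n\<close>.\<close>

lemma has_sum_linear_growth:
  "((\<lambda>k. \<bar>\<gamma> k\<bar> * (L * (n + 2 * real_of_int \<bar>k\<bar>))) has_sum L * (n * l1_norm \<gamma> + K_decimation \<gamma>)) UNIV"
proof -
  have "((\<lambda>k. \<bar>\<gamma> k\<bar>) has_sum l1_norm \<gamma>) UNIV"
    unfolding l1_norm_def using summable by (rule has_sum_infsum)
  moreover have "((\<lambda>k. \<bar>\<gamma> k\<bar> * real_of_int \<bar>k\<bar>) has_sum (\<Sum>\<^sub>\<infinity>k. \<bar>\<gamma> k\<bar> * real_of_int \<bar>k\<bar>)) UNIV"
    using moment by (intro has_sum_infsum) (simp add: mult.commute)
  ultimately have "((\<lambda>k. L * n * \<bar>\<gamma> k\<bar> + L * 2 * (\<bar>\<gamma> k\<bar> * real_of_int \<bar>k\<bar>)) has_sum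
      L * n * l1_norm \<gamma> + L * 2 * (\<Sum>\<^sub>\<infinity>k. \<bar>\<gamma> k\<bar> * real_of_int \<bar>k\<bar>)) UNIV"
    by (intro has_sum_add has_sum_cmult_right)
  then show ?thesis
    by (simp add: K_decimation_def algebra_simps)
qed

text \<open>As the filter has mass one, \<open>c\<^sub>j\<close> can be moved under its sum, and only differences of
  \<^term>\<open>c\<close> remain.  They grow at most linearly in the filter index, so the first moment of the filter
  makes their sum converge; adding the constant part back gives
  convergence of the decimation sum itself.  Entry \<open>i\<close> of the decimated sequence is compared with
  \<open>c\<^sub>j\<close> because it sits at position \<open>2 i\<close> of the finer grid.\<close>

lemma decimation_consistency:
  assumes lip: "lipschitz_seq L c"
  shows "(\<lambda>k. \<gamma> k * c (2 * i - 2 * k)) summable_on UNIV"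
    and "\<bar>c j - decimation \<gamma> c i\<bar> \<le> L * (real_of_int \<bar>j - 2 * i\<bar> * l1_norm \<gamma> + K_decimation \<gamma>)"
proof -
  define D where "D = (\<lambda>k. \<gamma> k * (c j - c (2 * i - 2 * k)))"
  have le: "\<bar>D k\<bar> \<le> \<bar>\<gamma> k\<bar> * (L * (real_of_int \<bar>j - 2 * i\<bar> + 2 * real_of_int \<bar>k\<bar>))" for k
  proof -
    have "\<bar>c j - c (2 * i - 2 * k)\<bar> \<le> L * real_of_int \<bar>j - (2 * i - 2 * k)\<bar>"
      using lip by (rule lipschitz_seqD)
    also have "\<dots> \<le> L * (real_of_int \<bar>j - 2 * i\<bar> + 2 * real_of_int \<bar>k\<bar>)"
      using lipschitz_seq_nonneg[OF lip] by (intro mult_left_mono) linarith+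
    finally show ?thesis
      by (simp add: D_def abs_mult mult_left_mono)
  qed
  note growth = has_sum_linear_growth[of L "real_of_int \<bar>j - 2 * i\<bar>"]
  note D = abs_infsum_le[OF has_sum_imp_summable[OF growth] le]
  have const: "((\<lambda>k. \<gamma> k * c j) has_sum c j) UNIV"
    using has_sum_cmult_left[OF has_sum_infsum[OF filter_summable], of "c j"] mass by simp
  have "((\<lambda>k. \<gamma> k * c j - D k) has_sum c j - infsum D UNIV) UNIV"
    by (intro has_sum_diff const has_sum_infsum D(1))
  then have dec: "((\<lambda>k. \<gamma> k * c (2 * i - 2 * k)) has_sum c j - infsum D UNIV) UNIV"
    by (simp add: D_def algebra_simps)
  then show "(\<lambda>k. \<gamma> k * c (2 * i - 2 * k)) summable_on UNIV"
    by (rule has_sum_imp_summable)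
  have "decimation \<gamma> c i = c j - infsum D UNIV"
    unfolding decimation_filter_form using dec by (rule infsumI)
  then show "\<bar>c j - decimation \<gamma> c i\<bar> \<le> L * (real_of_int \<bar>j - 2 * i\<bar> * l1_norm \<gamma> + K_decimation \<gamma>)"
    using D(2) infsumI[OF growth] by simp
qed

lemma decimation_lipschitz:
  assumes lip: "lipschitz_seq L c"
  shows "lipschitz_seq (2 * L * l1_norm \<gamma>) (decimation \<gamma> c)"
  unfolding lipschitz_seq_def
proof (intro allI)
  fix i j
  let ?D = "\<lambda>k. \<gamma> k * c (2 * i - 2 * k) - \<gamma> k * c (2 * j - 2 * k)"
  have bound: "((\<lambda>k. 2 * L * real_of_int \<bar>i - j\<bar> * \<bar>\<gamma> k\<bar>) has_sum 2 * L * real_of_int \<bar>i - j\<bar> * l1_norm \<gamma>) UNIV"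
    unfolding l1_norm_def using summable by (intro has_sum_cmult_right has_sum_infsum)
  have le: "\<bar>?D k\<bar> \<le> 2 * L * real_of_int \<bar>i - j\<bar> * \<bar>\<gamma> k\<bar>" for k
  proof -
    have "\<bar>?D k\<bar> = \<bar>\<gamma> k\<bar> * \<bar>c (2 * i - 2 * k) - c (2 * j - 2 * k)\<bar>"
      by (simp only: abs_mult flip: right_diff_distrib)
    also have "\<dots> \<le> \<bar>\<gamma> k\<bar> * (L * real_of_int \<bar>(2 * i - 2 * k) - (2 * j - 2 * k)\<bar>)"
      by (intro mult_left_mono lipschitz_seqD lip) simp
    also have "\<bar>(2 * i - 2 * k) - (2 * j - 2 * k)\<bar> = 2 * \<bar>i - j\<bar>"
      by presburger
    finally show ?thesis
      by (simp add: mult_ac)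
  qed
  have "decimation \<gamma> c i - decimation \<gamma> c j = infsum ?D UNIV"
    unfolding decimation_filter_form
    by (intro infsumI[symmetric] has_sum_diff has_sum_infsum decimation_consistency(1)[OF lip])
  then show "\<bar>decimation \<gamma> c i - decimation \<gamma> c j\<bar> \<le> 2 * L * l1_norm \<gamma> * real_of_int \<bar>i - j\<bar>"
    using abs_infsum_le(2)[OF has_sum_imp_summable[OF bound] le] infsumI[OF bound]
    by (simp add: mult_ac)
qed

section \<open>Detail coefficients\<close>

text \<open>The parity class of the mask has mass one, so \<open>c\<^sub>j\<close> also moves under the subdivision sum and each
  entry of the mask multiplies an error of \<open>decimation_consistency\<close> at distance \<open>n = j - 2 i\<close>.
  Summing over all \<open>n\<close> rather than over the parity class only increases the bound, and makes it
  uniform in \<^term>\<open>j\<close>.\<close>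

lemma detail_bound:
  assumes lip: "lipschitz_seq L c"
    and fin: "finite {i. \<alpha> i \<noteq> 0}"
    and even: "(\<Sum>\<^sub>\<infinity>i. \<alpha> (2 * i)) = 1" and odd: "(\<Sum>\<^sub>\<infinity>i. \<alpha> (2 * i + 1)) = 1"
  shows "\<bar>c j - subdivision \<alpha> (decimation \<gamma> c) j\<bar> \<le> K_pair \<alpha> \<gamma> * L"
proof -
  define D where "D = (\<lambda>i. \<alpha> (j - 2 * i) * (c j - decimation \<gamma> c i))"
  define M where "M = (\<lambda>n. \<bar>\<alpha> n\<bar> * (L * (real_of_int \<bar>n\<bar> * l1_norm \<gamma> + K_decimation \<gamma>)))"
  have fin_summable: "g summable_on UNIV" if "\<And>n. \<alpha> n = 0 \<Longrightarrow> g n = 0" for g :: "int \<Rightarrow> real"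
    by (rule finite_nonzero_values_imp_summable_on) (use that in \<open>auto intro: finite_subset[OF _ fin]\<close>)
  have "finite ((\<lambda>i. j - 2 * i) -` {i. \<alpha> i \<noteq> 0})"
    using fin by (rule finite_vimageI) (auto simp: inj_on_def)
  then have fin_shift: "g summable_on UNIV" if "\<And>i. \<alpha> (j - 2 * i) = 0 \<Longrightarrow> g i = 0" for g :: "int \<Rightarrow> real"
    by (intro finite_nonzero_values_imp_summable_on) (use that in \<open>auto elim!: rev_finite_subset\<close>)

  have "((\<lambda>i. \<alpha> (j - 2 * i) * c j) has_sum 1 * c j) UNIV"
    unfolding infsum_parity_class_mask[OF even odd, of j, symmetric]
    by (intro has_sum_cmult_left has_sum_infsum fin_shift)
  moreover have "((\<lambda>i. \<alpha> (j - 2 * i) * decimation \<gamma> c i) has_sum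
      subdivision \<alpha> (decimation \<gamma> c) j) UNIV"
    unfolding subdivision_def by (intro has_sum_infsum fin_shift) simp
  ultimately have "(D has_sum c j - subdivision \<alpha> (decimation \<gamma> c) j) UNIV"
    unfolding D_def right_diff_distrib by (auto intro: has_sum_diff)
  then have "c j - subdivision \<alpha> (decimation \<gamma> c) j = infsum D UNIV"
    by (simp add: infsumI)
  also have "\<bar>\<dots>\<bar> \<le> (\<Sum>\<^sub>\<infinity>i. M (j - 2 * i))"
  proof (rule abs_infsum_le(2))
    show "(\<lambda>i. M (j - 2 * i)) summable_on UNIV"
      by (rule fin_shift) (simp add: M_def)
    show "\<bar>D i\<bar> \<le> M (j - 2 * i)" for i
      unfolding D_def M_def abs_mult by (intro mult_left_mono decimation_consistency(2) lip) simp
  qed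
  also have "\<dots> \<le> infsum M UNIV"
    using lipschitz_seq_nonneg[OF lip] l1_norm_nonneg K_decimation_nonneg
    by (intro infsum_even_shift_le(2) fin_summable) (auto simp: M_def)
  also have "infsum M UNIV = K_pair \<alpha> \<gamma> * L"
  proof -
    have "((\<lambda>n. (L * l1_norm \<gamma>) * (\<bar>\<alpha> n\<bar> * real_of_int \<bar>n\<bar>) + (L * K_decimation \<gamma>) * \<bar>\<alpha> n\<bar>) has_sum
        (L * l1_norm \<gamma>) * K_mask \<alpha> + (L * K_decimation \<gamma>) * l1_norm \<alpha>) UNIV"
      unfolding K_mask_def l1_norm_def[of \<alpha>]
      by (intro has_sum_add has_sum_cmult_right has_sum_infsum fin_summable) auto
    then have "(M has_sum K_pair \<alpha> \<gamma> * L) UNIV"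
      by (simp add: M_def K_pair_def algebra_simps)
    then show ?thesis
      by (rule infsumI)
  qed
  finally show ?thesis .
qed

end

lemma sampled_lipschitz:
  fixes f f' :: "real \<Rightarrow> real"
  assumes deriv: "\<And>x. (f has_real_derivative f' x) (at x)" and bdd: "bounded (range f')"
    and "0 < h"
  shows "lipschitz_seq (sup_norm f' * h) (\<lambda>k. f (real_of_int k * h))"
  unfolding lipschitz_seq_def
proof (intro allI)
  fix i j :: int
  have "bdd_above (range (\<lambda>x. \<bar>f' x\<bar>))"
    using bdd by (auto simp: bounded_iff bdd_above_def)
  then have "\<bar>f' x\<bar> \<le> sup_norm f'" for x
    unfolding sup_norm_def by (intro cSUP_upper) auto
  then have "norm (f (i * h) - f (j * h)) \<le> sup_norm f' * norm (i * h - j * h)"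
    by (intro field_differentiable_bound[where S = UNIV and f' = f']) (auto intro: deriv)
  also have "norm (i * h - j * h) = h * real_of_int \<bar>i - j\<bar>"
    using \<open>0 < h\<close> by (simp add: abs_mult flip: left_diff_distrib)
  finally show "\<bar>f (i * h) - f (j * h)\<bar> \<le> sup_norm f' * h * real_of_int \<bar>i - j\<bar>"
    by (simp add: mult_ac)
qed

theorem theorem3p3:
  fixes f f' :: "real \<Rightarrow> real"
    and J :: nat
    and \<alpha> \<gamma> c d :: "nat \<Rightarrow> int \<Rightarrow> real"
  assumes f_bounded: "bounded (range f)"
    and f_deriv: "\<And>x. (f has_real_derivative f' x) (at x)"
    and f'_continuous: "continuous_on UNIV f'"
    and f'_bounded: "bounded (range f')"
    and mask_finite: "\<And>l. l \<in> {1..J} \<Longrightarrow> finite {i. \<alpha> l i \<noteq> 0}"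
    and mask_even: "\<And>l. l \<in> {1..J} \<Longrightarrow> (\<Sum>\<^sub>\<infinity>i. \<alpha> l (2 * i)) = 1"
    and mask_odd: "\<And>l. l \<in> {1..J} \<Longrightarrow> (\<Sum>\<^sub>\<infinity>i. \<alpha> l (2 * i + 1)) = 1"
    and gamma_summable: "\<And>l. l \<in> {1..J} \<Longrightarrow> (\<lambda>i. \<bar>\<gamma> l i\<bar>) summable_on UNIV"
    and gamma_inverse: "\<And>l. l \<in> {1..J} \<Longrightarrow> convolution (\<gamma> l) (downsample (\<alpha> l)) = kronecker_delta"
    and gamma_sum: "\<And>l. l \<in> {1..J} \<Longrightarrow> (\<Sum>\<^sub>\<infinity>i. \<gamma> l i) = 1"
    and gamma_moment: "\<And>l. l \<in> {1..J} \<Longrightarrow> (\<lambda>i. real_of_int \<bar>i\<bar> * \<bar>\<gamma> l i\<bar>) summable_on UNIV"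
    and samples: "c J = (\<lambda>k. f (real_of_int k / 2 ^ J))"
    and coarse: "\<And>l. l \<in> {1..J} \<Longrightarrow> c (l - 1) = decimation (\<gamma> l) (c l)"
    and detail: "\<And>l. l \<in> {1..J} \<Longrightarrow> d l = (\<lambda>j. c l j - subdivision (\<alpha> l) (c (l - 1)) j)"
  shows "\<forall>l\<in>{1..J}. bounded (range (d l)) \<and>
           sup_norm (d l) \<le> (K_pair (\<alpha> l) (\<gamma> l) * sup_norm f' * (\<Prod>m=l+1..J. l1_norm (\<gamma> m))) * (1 / 2 ^ l)"
proof
  \<comment> \<open>This solves the recursion \<open>L\<^sub>l = 2 L\<^sub>l\<^sub>+\<^sub>1 \<parallel>\<gamma>\<^sup>(\<^sup>l\<^sup>+\<^sup>1\<^sup>)\<parallel>\<^sub>1\<close> downwards from the sampling level \<open>J\<close>.\<close>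
  define L where "L l = sup_norm f' * (\<Prod>m=l+1..J. l1_norm (\<gamma> m)) * (1 / 2 ^ l)" for l
  have filter: "moment_filter (\<gamma> l)" if "l \<in> {1..J}" for l
    using that by (intro moment_filter.intro gamma_summable gamma_moment gamma_sum)
  have L_rec: "L l = 2 * L (Suc l) * l1_norm (\<gamma> (Suc l))" if "l < J" for l
    using that by (simp add: L_def prod.atLeast_Suc_atMost[of "Suc l" J])
  have lip: "lipschitz_seq (L l) (c l)" if "l \<le> J" for l
    using that
  proof (induction rule: inc_induct)
    case base
    show ?case
      using sampled_lipschitz[OF f_deriv f'_bounded, of "1 / 2 ^ J"] by (simp add: L_def samples)
  next
    case (step l)
    then have "lipschitz_seq (2 * L (Suc l) * l1_norm (\<gamma> (Suc l))) (decimation (\<gamma> (Suc l)) (c (Suc l)))"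
      by (intro moment_filter.decimation_lipschitz filter) auto
    then show ?case
      using \<open>l < J\<close> coarse[of "Suc l"] by (simp add: L_rec)
  qed
  fix l assume l: "l \<in> {1..J}"
  let ?B = "K_pair (\<alpha> l) (\<gamma> l) * L l"
  have "\<bar>d l j\<bar> \<le> ?B" for j
    unfolding detail[OF l] coarse[OF l]
    using l by (intro moment_filter.detail_bound filter lip mask_finite mask_even mask_odd) auto
  then have "bounded (range (d l))" and "sup_norm (d l) \<le> ?B"
    by (auto simp: bounded_iff sup_norm_def intro!: cSUP_least)
  then show "bounded (range (d l)) \<and>
      sup_norm (d l) \<le> (K_pair (\<alpha> l) (\<gamma> l) * sup_norm f' * (\<Prod>m=l+1..J. l1_norm (\<gamma> m))) * (1 / 2 ^ l)"
    by (simp add: L_def mult_ac)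
qed

end
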